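(* Let $p,q,r\in\mathcal{P}_d(\mathbb{R})$. Then (1) $d_K(p\boxplus_d r,q\boxplus_d r)\le d_K(p,q)$; (2) $d_L(p\boxplus_d r,q\boxplus_d r)\le d_L(p,q)$.
   Context: $\mathcal{P}_d(\mathbb{R})$: monic real-rooted polynomials of degree $d$. For $p$ with roots $\lambda_i$, $p(x)=\sum_{k=0}^d(-1)^k\binom{d}{k}\tilde e_k(p)x^{d-k}$ with $\tilde e_k(p)=\binom{d}{k}^{-1}e_k(\lambda_1,\dots,\lambda_d)$; $p\boxplus_d q$ is defined by $\tilde e_k(p\boxplus_d q)=\sum_{i=0}^k\binom{k}{i}\tilde e_i(p)\tilde e_{k-i}(q)$. $\mu_p=\frac1d\sum_i\delta_{\lambda_i}$ and $\mathcal{F}_p$ is its CDF. For probability measures $\mu,\nu$ on $\mathbb{R}$: Kolmogorov distance $d_K(\mu,\nu)=\inf\{\epsilon>0:\mathcal{F}_\mu(x)-\epsilon\le\mathcal{F}_\nu(x)\le\mathcal{F}_\mu(x)+\epsilon\ \forall x\}$; Lévy distance $d_L(\mu,\nu)=\inf\{\epsilon>0:\mathcal{F}_\mu(x-\epsilon)-\epsilon\le\mathcal{F}_\nu(x)\le\mathcal{F}_\mu(x+\epsilon)+\epsilon\ \forall x\}$. For polynomials, $d_K(p,q):=d_K(\mu_p,\mu_q)$ and $d_L(p,q):=d_L(\mu_p,\mu_q)$. *)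

theory Defs
  imports "HOL-Analysis.Analysis" "HOL-Computational_Algebra.Polynomial" "HOL-Library.Multiset"
begin

definition real_rooted_monic :: "nat \<Rightarrow> real poly set" where
  "real_rooted_monic d = {p. \<exists>A :: real multiset. size A = d \<and>
       p = (\<Prod>a\<in>#A. [:-a, 1:])}"

text \<open>Normalized elementary symmetric function of the roots, read off from the coefficient
  expansion p(x) = sum_k (-1)^k (d choose k) e~_k(p) x^(d-k).\<close>
definition etilde :: "nat \<Rightarrow> real poly \<Rightarrow> nat \<Rightarrow> real" where
  "etilde d p k = (-1)^k * coeff p (d - k) / real (d choose k)"

definition ffconv :: "nat \<Rightarrow> real poly \<Rightarrow> real poly \<Rightarrow> real poly" where
  "ffconv d p q = (\<Sum>k\<le>d. monom ((-1)^k * real (d choose k) *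
       (\<Sum>i\<le>k. real (k choose i) * etilde d p i * etilde d q (k - i))) (d - k))"

definition root_cdf :: "nat \<Rightarrow> real poly \<Rightarrow> real \<Rightarrow> real" where
  "root_cdf d p x = (\<Sum>r\<in>{r. poly p r = 0 \<and> r \<le> x}. real (order r p)) / real d"

definition kolmogorov_dist :: "(real \<Rightarrow> real) \<Rightarrow> (real \<Rightarrow> real) \<Rightarrow> real" where
  "kolmogorov_dist F G = Inf {e. e > 0 \<and> (\<forall>x. F x - e \<le> G x \<and> G x \<le> F x + e)}"

definition levy_dist :: "(real \<Rightarrow> real) \<Rightarrow> (real \<Rightarrow> real) \<Rightarrow> real" where
  "levy_dist F G = Inf {e. e > 0 \<and> (\<forall>x. F (x - e) - e \<le> G x \<and> G x \<le> F (x + e) + e)}"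

definition dK_poly :: "nat \<Rightarrow> real poly \<Rightarrow> real poly \<Rightarrow> real" where
  "dK_poly d p q = kolmogorov_dist (root_cdf d p) (root_cdf d q)"

definition dL_poly :: "nat \<Rightarrow> real poly \<Rightarrow> real poly \<Rightarrow> real" where
  "dL_poly d p q = levy_dist (root_cdf d p) (root_cdf d q)"

end

theory Submission
  imports Defs "HOL-Computational_Algebra.Fundamental_Theorem_Algebra" "HOL-Real_Asymp.Real_Asymp"
begin

text \<open>Write \<open>T p\<close> for the convolution of \<open>p\<close> with a fixed real-rooted \<open>r\<close>. Grace's argument with
  polar derivatives shows that \<open>T p\<close> has no root in the open lower half plane when the roots of
  \<open>p\<close> lie in the closed upper half plane. For \<open>p = (x - z) g\<close> with \<open>g\<close> real-rooted this says that
  \<open>T (x g) - z T g\<close> does not vanish there for any \<open>z\<close> in the closed upper half plane, and so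
  \<open>Im (T ((x - b) g) w * cnj (T ((x - a) g) w)) \<le> 0\<close> for real \<open>a \<le> b\<close> and \<open>Im w < 0\<close>.
  Following the argument of the quotient down to the real axis, one finds that moving one root of
  \<open>p\<close> to the right decreases the number of roots of \<open>T p\<close> below any given point by \<open>0\<close> or \<open>1\<close>.
  Moving the roots one at a time, a bound \<open>N\<^sub>q \<le> N\<^sub>p + k\<close> between root counts passes to
  \<open>T q\<close> and \<open>T p\<close>. The Levy case follows as well, because \<open>T\<close> commutes with translations.\<close>

section \<open>Roots in a half plane and polar derivatives\<close>

definition root_poly :: "'a::comm_ring_1 multiset \<Rightarrow> 'a poly" where
  "root_poly A = (\<Prod>a\<in>#A. [:-a, 1:])"

lemma root_poly_empty [simp]: "root_poly {#} = 1"
  and root_poly_add_mset [simp]: "root_poly (add_mset a A) = [:-a, 1:] * root_poly A"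
  by (simp_all add: root_poly_def)

lemma poly_root_poly: "poly (root_poly A) x = (\<Prod>a\<in>#A. x - a)"
  by (induction A) (auto simp: algebra_simps)

lemma root_poly_nonzero [simp]: "root_poly (A :: 'a::idom multiset) \<noteq> 0"
  by (induction A) (auto simp del: mult_pCons_left)

lemma degree_root_poly [simp]: "degree (root_poly (A :: 'a::idom multiset)) = size A"
  by (induction A) (auto simp: degree_mult_eq simp del: mult_pCons_left)

lemma lead_coeff_root_poly [simp]: "coeff (root_poly (A :: 'a::idom multiset)) (size A) = 1"
proof -
  have "lead_coeff (root_poly A) = 1"
    by (induction A) (simp_all add: lead_coeff_mult del: degree_root_poly mult_pCons_left)
  then show ?thesis by simp
qed

lemma coeff_root_poly_second:
  "coeff (root_poly (add_mset a A)) (size A) = - (\<Sum>b\<in>#add_mset a (A :: 'a::idom multiset). b)"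
proof (induction A arbitrary: a)
  case (add b A)
  have "coeff (root_poly (add_mset a (add_mset b A))) (Suc (size A))
      = coeff (root_poly (add_mset b A)) (size A) - a * coeff (root_poly (add_mset b A)) (size (add_mset b A))"
    by (subst root_poly_add_mset) simp
  also have "\<dots> = - (\<Sum>b\<in>#add_mset b A. b) - a"
    by (simp only: add.IH lead_coeff_root_poly) simp
  finally show ?case by (simp add: algebra_simps)
qed simp

lemma proots_root_poly [simp]: "proots (root_poly (A :: 'a::idom multiset)) = A"
  by (induction A) (simp_all add: proots_mult del: mult_pCons_left)

lemma poly_pderiv_root_poly:
  fixes x :: "'a::field"
  assumes "x \<notin># A"
  shows "poly (pderiv (root_poly A)) x = poly (root_poly A) x * (\<Sum>a\<in>#A. 1 / (x - a))"
  using assms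
proof (induction A)
  case (add a A)
  have "poly (pderiv (root_poly (add_mset a A))) x
      = poly (root_poly A) x + (x - a) * poly (pderiv (root_poly A)) x"
    unfolding root_poly_add_mset pderiv_mult by (simp add: pderiv_pCons algebra_simps)
  also have "\<dots> = (x - a) * poly (root_poly A) x * (1 / (x - a) + (\<Sum>a\<in>#A. 1 / (x - a)))"
    using add by (simp add: distrib_left)
  also have "(x - a) * poly (root_poly A) x = poly (root_poly (add_mset a A)) x"
    by (simp add: algebra_simps)
  finally show ?case by simp
qed simp

text \<open>The polar derivative \<open>n p + (z - x) p'\<close> with pole \<open>z\<close>. With
  nominal degree \<open>n\<close>, the coefficient of \<open>x ^ n\<close> vanishes whenever
  \<open>p\<close> has degree at most \<open>n\<close>.\<close>

definition polar :: "nat \<Rightarrow> 'a::idom \<Rightarrow> 'a poly \<Rightarrow> 'a poly" where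
  "polar n z p = smult (of_nat n) p + [:z, -1:] * pderiv p"

lemma coeff_polar:
  "coeff (polar n z p) k = (of_nat n - of_nat k) * coeff p k + z * of_nat (Suc k) * coeff p (Suc k)"
proof (cases k)
  case 0
  then show ?thesis by (simp add: polar_def coeff_pderiv)
next
  case (Suc j)
  then show ?thesis by (simp add: polar_def coeff_pderiv algebra_simps)
qed

text \<open>The logarithmic derivative of the product is the sum of the \<open>1 / (x - a)\<close>,
  and \<open>1 + (z - x) / (x - a) = (z - a) / (x - a)\<close>.\<close>

lemma poly_polar_root_poly:
  fixes x :: "'a::field"
  assumes "x \<notin># A"
  shows "poly (polar (size A) z (root_poly A)) x
    = poly (root_poly A) x * (\<Sum>a\<in>#A. (z - a) / (x - a))"
proof -
  have "of_nat (size A) + (z - x) * (\<Sum>a\<in>#A. 1 / (x - a)) = (\<Sum>a\<in>#A. (z - a) / (x - a))"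
    using assms
  proof (induction A)
    case (add a A)
    then have "(z - a) / (x - a) = 1 + (z - x) * (1 / (x - a))" by (simp add: field_simps)
    then show ?case using add by (simp add: algebra_simps)
  qed simp
  moreover have "poly (polar (size A) z (root_poly A)) x
      = poly (root_poly A) x * (of_nat (size A) + (z - x) * (\<Sum>a\<in>#A. 1 / (x - a)))"
    by (simp only: polar_def poly_add poly_smult poly_mult poly_pderiv_root_poly[OF assms])
      (simp add: algebra_simps)
  ultimately show ?thesis by simp
qed

text \<open>The quotients \<open>(z - b) / (x - b)\<close> lie in a closed disc with centre \<open>(z - cnj x) / (x - cnj x)\<close>
  that does not contain the origin, since \<open>b = z\<close> is excluded; hence so does their mean.\<close>
lemma sum_quotients_nonzero:
  fixes B :: "complex multiset"
  assumes "B \<noteq> {#}" "\<And>b. b \<in># B \<Longrightarrow> Im b \<ge> 0" "Im z < 0" "Im x < 0"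
  shows "(\<Sum>b\<in>#B. (z - b) / (x - b)) \<noteq> 0"
proof -
  define c where "c = z - cnj x"
  \<comment> \<open>Scaling by the nonzero \<open>x - cnj x\<close> moves the centre of the disc to
    \<open>c\<close>. Its radius becomes \<open>cmod (z - x)\<close>, less than
    \<open>cmod c\<close> because \<open>z\<close> and \<open>x\<close> lie in the same open half
    plane.\<close>
  define v where "v = (\<lambda>b. (z - b) / (x - b) * (x - cnj x))"
  have *: "cmod (v b - c) < cmod c" if "Im b \<ge> 0" for b
  proof -
    have ne: "x - b \<noteq> 0" using that assms by (auto simp: complex_eq_iff)
    have "v b - c = (z - x) * ((b - cnj x) / (x - b))"
      using ne by (simp add: v_def c_def field_simps)
    moreover have "cmod (b - cnj x) \<le> cmod (x - b)"
    proof -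
      have "(Im b + Im x)\<^sup>2 \<le> (Im x - Im b)\<^sup>2"
        using that assms by (simp add: power2_eq_square algebra_simps mult_nonneg_nonpos)
      moreover have "(Re b - Re x)\<^sup>2 = (Re x - Re b)\<^sup>2"
        by (simp add: power2_commute)
      ultimately show ?thesis by (simp add: cmod_def)
    qed
    then have "cmod ((b - cnj x) / (x - b)) \<le> 1"
      using ne by (simp add: norm_divide)
    ultimately have "cmod (v b - c) \<le> cmod (z - x)"
      by (metis mult.commute mult_left_le_one_le norm_ge_zero norm_mult)
    also have "(Im z - Im x)\<^sup>2 < (Im z + Im x)\<^sup>2"
      using assms by (simp add: power2_eq_square algebra_simps mult_neg_neg)
    then have "cmod (z - x) < cmod c" by (simp add: cmod_def c_def)
    finally show ?thesis .
  qed
  have "cmod ((\<Sum>b\<in>#B. v b) - of_nat (size B) * c) < real (size B) * cmod c"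
    using assms(1,2)
  proof (induction B)
    case (add b B)
    show ?case
    proof (cases "B = {#}")
      case True
      then show ?thesis using *[of b] add.prems by simp
    next
      case False
      have "cmod ((\<Sum>b\<in>#add_mset b B. v b) - of_nat (size (add_mset b B)) * c)
          = cmod ((v b - c) + ((\<Sum>b\<in>#B. v b) - of_nat (size B) * c))"
        by (simp add: algebra_simps)
      also have "\<dots> \<le> cmod (v b - c) + cmod ((\<Sum>b\<in>#B. v b) - of_nat (size B) * c)"
        by (rule norm_triangle_ineq)
      also have "\<dots> < cmod c + real (size B) * cmod c"
        using *[of b] add False by (intro add_strict_mono) auto
      finally show ?thesis by (simp add: algebra_simps)
    qed
  qed simp
  then have "(\<Sum>b\<in>#B. v b) \<noteq> 0" by (auto simp: norm_mult)
  moreover have "(\<Sum>b\<in>#B. v b) = (\<Sum>b\<in>#B. (z - b) / (x - b)) * (x - cnj x)"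
    by (simp add: v_def sum_mset_distrib_right)
  ultimately show ?thesis by auto
qed

text \<open>Laguerre's theorem for a half plane. The coefficient of \<open>x ^ n\<close> is
  \<open>(n + 1) z\<close> minus the sum of the roots; its imaginary part is negative, so the degree
  is exactly \<open>n\<close>. A root below the real axis would be a zero of the sum of
  quotients.\<close>

lemma polar_upper_half_plane:
  fixes B :: "complex multiset"
  assumes sz: "size B = Suc n" and B: "\<And>b. b \<in># B \<Longrightarrow> Im b \<ge> 0" and z: "Im z < 0"
  shows "\<exists>c B'. c \<noteq> 0 \<and> size B' = n \<and> (\<forall>b\<in>#B'. Im b \<ge> 0) \<and>
    polar (Suc n) z (root_poly B) = smult c (root_poly B')"
proof -
  let ?q = "polar (Suc n) z (root_poly B)"
  obtain b B0 where BB: "B = add_mset b B0" "size B0 = n"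
    using sz by (metis size_eq_Suc_imp_eq_union size_add_mset nat.inject)
  have le: "degree ?q \<le> n"
  proof (rule degree_le, intro allI impI)
    fix i assume "n < i"
    then show "coeff ?q i = 0"
      using sz by (cases "i = Suc n") (auto simp: coeff_polar coeff_eq_0)
  qed
  have "coeff ?q n = z * of_nat (Suc n) - (\<Sum>b\<in>#B. b)"
    using coeff_root_poly_second[of b B0] lead_coeff_root_poly[of B] sz BB
    by (simp add: coeff_polar algebra_simps del: root_poly_add_mset)
  moreover have "Im (\<Sum>b\<in>#B. b) \<ge> 0" using B by (induction B) auto
  moreover have "Im (z * of_nat (Suc n)) < 0" using z by (simp add: mult_neg_pos)
  ultimately have "Im (coeff ?q n) < 0" by simp
  then have nz: "coeff ?q n \<noteq> 0" by auto
  then have deg: "degree ?q = n" using le le_degree by (metis order_antisym)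
  obtain B' where B': "size B' = n" "?q = smult (coeff ?q n) (root_poly B')"
    using alg_closed_imp_factorization[of ?q, folded root_poly_def] deg nz by fastforce
  have "Im x \<ge> 0" if "x \<in># B'" for x
  proof (rule ccontr)
    assume x: "\<not> Im x \<ge> 0"
    have "poly (root_poly B') x = 0" using that by (simp add: poly_root_poly prod_mset_zero_iff)
    then have "poly ?q x = 0" by (metis B'(2) poly_smult mult_zero_right)
    moreover have "x \<notin># B" using B x by auto
    ultimately have "poly (root_poly B) x = 0 \<or> (\<Sum>b\<in>#B. (z - b) / (x - b)) = 0"
      using poly_polar_root_poly[of x B z] sz by simp
    moreover have "poly (root_poly B) x \<noteq> 0"
      using \<open>x \<notin># B\<close> by (auto simp: poly_root_poly prod_mset_zero_iff)
    moreover have "B \<noteq> {#}" using sz by auto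
    ultimately show False using sum_quotients_nonzero[of B z x] B z x by auto
  qed
  then show ?thesis using nz B' by (intro exI[of _ "coeff ?q n"] exI[of _ B']) auto
qed

section \<open>The convolution as a differential operator\<close>

lemma smult_sum_right: "smult c (sum f I) = (\<Sum>i\<in>I. smult c (f i))"
  by (induction I rule: infinite_finite_induct) (simp_all add: smult_add_right)

text \<open>As a differential operator with coefficients from \<open>r\<close>, the convolution is
  visibly linear and commutes with translations. The field is left general because the nonvanishing
  argument runs over \<open>complex\<close>.\<close>

definition deriv_conv :: "nat \<Rightarrow> 'a::field_char_0 poly \<Rightarrow> 'a poly \<Rightarrow> 'a poly" where
  "deriv_conv d r p = (\<Sum>i\<le>d. smult (fact (d - i) / fact d * coeff r (d - i)) ((pderiv ^^ i) p))"

lemma deriv_conv_add: "deriv_conv d r (p + q) = deriv_conv d r p + deriv_conv d r q"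
  by (simp add: deriv_conv_def higher_pderiv_add smult_add_right sum.distrib)

lemma deriv_conv_smult: "deriv_conv d r (smult c p) = smult c (deriv_conv d r p)"
  by (simp add: deriv_conv_def higher_pderiv_smult smult_sum_right mult_ac)

lemma deriv_conv_diff: "deriv_conv d r (p - q) = deriv_conv d r p - deriv_conv d r q"
  using deriv_conv_add[of d r p "smult (-1) q"] unfolding deriv_conv_smult by simp

lemma deriv_conv_smult_left: "deriv_conv d (smult c r) p = smult c (deriv_conv d r p)"
  by (simp add: deriv_conv_def smult_sum_right mult_ac)

lemma poly_deriv_conv:
  "poly (deriv_conv d r p) w
    = (\<Sum>i\<le>d. fact (d - i) / fact d * coeff r (d - i) * poly ((pderiv ^^ i) p) w)"
  by (simp add: deriv_conv_def poly_sum)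

lemma coeff_deriv_conv:
  "coeff (deriv_conv d r p) k
    = (\<Sum>i\<le>d. fact (d - i) / fact d * coeff r (d - i) * (pochhammer (of_nat (Suc k)) i * coeff p (k + i)))"
  by (simp add: deriv_conv_def coeff_sum coeff_higher_pderiv)

lemma degree_deriv_conv: "degree p \<le> d \<Longrightarrow> degree (deriv_conv d r p) \<le> d"
  by (intro degree_le) (auto simp: coeff_deriv_conv coeff_eq_0 intro!: sum.neutral)

lemma coeff_deriv_conv_top:
  assumes "degree p \<le> d"
  shows "coeff (deriv_conv d r p) d = coeff r d * coeff p d"
proof -
  have "coeff (deriv_conv d r p) d = (\<Sum>i\<le>d. if i = 0 then coeff r d * coeff p d else 0)"
    unfolding coeff_deriv_conv using assms by (intro sum.cong) (auto simp: coeff_eq_0)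
  then show ?thesis by (simp add: sum.delta)
qed

text \<open>Both coefficients of \<open>x ^ (d - k)\<close> are combinations of the products
  \<open>coeff p (d - i) * coeff r (d - (k - i))\<close> with the same factorial weights.\<close>

lemma ffconv_eq_deriv_conv:
  assumes "degree p \<le> d"
  shows "ffconv d p r = deriv_conv d r p"
proof (rule poly_eqI)
  fix n
  define c where "c k = (-1)^k * real (d choose k) *
       (\<Sum>i\<le>k. real (k choose i) * etilde d p i * etilde d r (k - i))" for k
  have L: "coeff (ffconv d p r) n = (\<Sum>k\<le>d. if d - k = n then c k else 0)"
    unfolding ffconv_def c_def coeff_sum coeff_monom ..
  show "coeff (ffconv d p r) n = coeff (deriv_conv d r p) n"
  proof (cases "n \<le> d")
    case False
    then show ?thesis
      using assms degree_deriv_conv[OF assms, of r] by (auto simp: L coeff_eq_0 intro!: sum.neutral)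
  next
    case n: True
    define k where "k = d - n"
    have k: "k \<le> d" "n = d - k" using n by (auto simp: k_def)
    have "(\<Sum>k\<le>d. if d - k = n then c k else 0) = (\<Sum>j\<le>d. if j = k then c j else 0)"
      using n by (intro sum.cong) (auto simp: k_def)
    then have "coeff (ffconv d p r) n = (\<Sum>j\<le>d. if j = k then c j else 0)" by (simp only: L)
    also have "\<dots> = c k" using k by (simp add: sum.delta)
    also have "c k = (\<Sum>i\<le>k. (-1)^k * real (d choose k) * real (k choose i) * etilde d p i * etilde d r (k - i))"
      by (simp add: c_def sum_distrib_left mult_ac)
    also have "\<dots> = (\<Sum>i\<le>k. fact (d - (k - i)) / fact d * coeff r (d - (k - i)) *
        (pochhammer (of_nat (Suc n)) (k - i) * coeff p (d - i)))"
    proof (rule sum.cong)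
      fix i assume "i \<in> {..k}"
      then have i: "i \<le> k" by simp
      have s: "(-1)^k * (-1)^i * (-1)^(k-i) = (1::real)"
        using i by (simp add: power_add[symmetric])
      have "pochhammer (real (Suc n)) (k - i) = fact (n + (k - i)) / fact n"
        by (metis pochhammer_fact pochhammer_product' nonzero_mult_div_cancel_left fact_nonzero
              of_nat_Suc add.commute)
      also have "n + (k - i) = d - i" using i k by simp
      finally have P: "pochhammer (real (Suc n)) (k - i) = fact (d - i) / fact (d - k)"
        by (simp add: k)
      \<comment> \<open>The binomials collapse to two factorial quotients, the second of which is
        the Pochhammer factor produced by differentiation.\<close>
      have "real (d choose k) * real (k choose i) / (real (d choose i) * real (d choose (k - i)))
          = fact (d - (k - i)) / fact d * (fact (d - i) / fact (d - k))"
        using i k by (simp add: binomial_fact field_simps)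
      then have "real (d choose k) * real (k choose i) / (real (d choose i) * real (d choose (k - i)))
          = fact (d - (k - i)) / fact d * pochhammer (real (Suc n)) (k - i)"
        using P by simp
      moreover have "(-1)^k * real (d choose k) * real (k choose i) * etilde d p i * etilde d r (k - i)
          = ((-1)^k * (-1)^i * (-1)^(k-i)) *
            (real (d choose k) * real (k choose i) / (real (d choose i) * real (d choose (k - i)))) *
            (coeff p (d - i) * coeff r (d - (k - i)))"
        by (simp add: etilde_def)
      ultimately show "(-1)^k * real (d choose k) * real (k choose i) * etilde d p i * etilde d r (k - i)
        = fact (d - (k - i)) / fact d * coeff r (d - (k - i)) *
        (pochhammer (of_nat (Suc n)) (k - i) * coeff p (d - i))"
        unfolding s by simp
    qed simp
    \<comment> \<open>Reversing the sum makes \<open>i\<close> the order of differentiation. Orders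
      \<open>i > k\<close> can then be added freely, since \<open>n + i > d\<close> there.\<close>
    also have "\<dots> = (\<Sum>i\<le>k. fact (d - i) / fact d * coeff r (d - i) *
        (pochhammer (of_nat (Suc n)) i * coeff p (n + i)))"
      by (rule sum.reindex_bij_witness[of _ "\<lambda>i. k - i" "\<lambda>i. k - i"]) (use k in auto)
    also have "\<dots> = coeff (deriv_conv d r p) n"
      unfolding coeff_deriv_conv using assms k
      by (intro sum.mono_neutral_left) (auto simp: coeff_eq_0)
    finally show ?thesis .
  qed
qed

text \<open>Leibniz's rule, where a linear factor leaves two terms. At \<open>i = 0\<close> the
  truncated \<open>i - 1\<close> is harmless, its term having the factor
  \<open>of_nat i\<close>.\<close>

lemma higher_pderiv_linear_mult:
  fixes q :: "'a::field_char_0 poly"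
  shows "(pderiv ^^ i) ([:-b, 1:] * q) = [:-b, 1:] * (pderiv ^^ i) q + smult (of_nat i) ((pderiv ^^ (i - 1)) q)"
proof (induction i)
  case (Suc i)
  have "pderiv (smult (of_nat i) ((pderiv ^^ (i - 1)) q)) = smult (of_nat i) ((pderiv ^^ i) q)"
    by (cases i) (simp_all add: pderiv_smult)
  moreover have "pderiv ([:-b, 1:] * (pderiv ^^ i) q)
      = (pderiv ^^ i) q + [:-b, 1:] * (pderiv ^^ Suc i) q"
    unfolding pderiv_mult by (simp add: pderiv_pCons)
  moreover have "(pderiv ^^ Suc i) ([:-b, 1:] * q)
      = pderiv ([:-b, 1:] * (pderiv ^^ i) q) + pderiv (smult (of_nat i) ((pderiv ^^ (i - 1)) q))"
    by (simp only: funpow.simps o_apply Suc.IH pderiv_add)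
  ultimately show ?case
    by (simp del: mult_pCons_left add: smult_add_left)
qed simp

text \<open>The reduction in Grace's argument: at a fixed point \<open>w\<close>, splitting a root
  \<open>b\<close> off one polynomial turns the other into its polar derivative with pole
  \<open>w - b\<close>.\<close>

lemma poly_deriv_conv_linear_mult:
  assumes "degree q \<le> n"
  shows "poly (deriv_conv (Suc n) r ([:-b, 1:] * q)) w
    = poly (deriv_conv n (polar (Suc n) (w - b) r) q) w / of_nat (Suc n)"
proof -
  define f where "f i = fact (Suc n - i) / fact (Suc n) * coeff r (Suc n - i)" for i
  define Q where "Q i = poly ((pderiv ^^ i) q) w" for i
  \<comment> \<open>The derivative of order \<open>Suc n\<close> vanishes, so the first of the two
    sums below can stop at \<open>n\<close>.\<close>
  have Q0: "Q (Suc n) = 0"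
  proof -
    have "(pderiv ^^ Suc n) q = 0"
      using assms by (intro poly_eqI) (simp only: coeff_higher_pderiv, simp add: coeff_eq_0)
    then show ?thesis by (simp only: Q_def) simp
  qed
  have "poly (deriv_conv (Suc n) r ([:-b, 1:] * q)) w
      = (\<Sum>i\<le>Suc n. f i * ((w - b) * Q i + of_nat i * Q (i - 1)))"
    unfolding poly_deriv_conv higher_pderiv_linear_mult f_def Q_def
    by (intro sum.cong) (simp_all add: algebra_simps)
  also have "\<dots> = (\<Sum>i\<le>Suc n. f i * (w - b) * Q i) + (\<Sum>i\<le>Suc n. f i * of_nat i * Q (i - 1))"
    by (simp only: distrib_left sum.distrib mult.assoc)
  also have "(\<Sum>i\<le>Suc n. f i * (w - b) * Q i) = (\<Sum>i\<le>n. f i * (w - b) * Q i)"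
    by (simp add: Q0)
  also have "(\<Sum>i\<le>Suc n. f i * of_nat i * Q (i - 1)) = (\<Sum>i\<le>n. f (Suc i) * of_nat (Suc i) * Q i)"
    by (subst sum.atMost_Suc_shift) simp
  also have "(\<Sum>i\<le>n. f i * (w - b) * Q i) + (\<Sum>i\<le>n. f (Suc i) * of_nat (Suc i) * Q i)
      = (\<Sum>i\<le>n. fact (n - i) / fact n * coeff (polar (Suc n) (w - b) r) (n - i) * Q i / of_nat (Suc n))"
    unfolding sum.distrib[symmetric]
  proof (intro sum.cong refl)
    fix i assume "i \<in> {..n}"
    then have i: "i \<le> n" by simp
    have e: "coeff (polar (Suc n) (w - b) r) (n - i)
        = of_nat (Suc i) * coeff r (n - i) + (w - b) * of_nat (Suc n - i) * coeff r (Suc n - i)"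
      using i by (simp add: coeff_polar Suc_diff_le of_nat_diff)
    have F: "fact (Suc n - i) = of_nat (Suc n - i) * (fact (n - i) :: 'a)"
      using i by (simp add: Suc_diff_le del: of_nat_Suc)
    have G: "fact (Suc n) = of_nat (Suc n) * (fact n :: 'a)" by simp
    have nz: "of_nat (Suc n) \<noteq> (0::'a)" by (rule of_nat_neq_0)
    show "f i * (w - b) * Q i + f (Suc i) * of_nat (Suc i) * Q i
        = fact (n - i) / fact n * coeff (polar (Suc n) (w - b) r) (n - i) * Q i / of_nat (Suc n)"
      unfolding e f_def F G diff_Suc_Suc using nz
      by (simp add: field_simps del: of_nat_Suc)
  qed
  also have "\<dots> = poly (deriv_conv n (polar (Suc n) (w - b) r) q) w / of_nat (Suc n)"
    by (simp add: poly_deriv_conv Q_def sum_divide_distrib)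
  finally show ?thesis .
qed

text \<open>Induction on the degree, splitting off a root \<open>a\<close> of the first polynomial.
  The pole \<open>w - a\<close> lies in the open lower half plane, so by
  \<open>polar_upper_half_plane\<close> the roots of the other one stay in the closed upper half
  plane.\<close>

lemma deriv_conv_nonzero_lower_half_plane:
  fixes P R :: "complex multiset"
  assumes "size P = d" "size R = d" "\<And>a. a \<in># P \<Longrightarrow> Im a \<ge> 0" "\<And>b. b \<in># R \<Longrightarrow> Im b \<ge> 0" "Im w < 0"
  shows "poly (deriv_conv d (root_poly R) (root_poly P)) w \<noteq> 0"
  using assms(1-4)
proof (induction d arbitrary: P R)
  case 0
  then show ?case by (simp add: deriv_conv_def)
next
  case (Suc n)
  obtain a P' where P: "P = add_mset a P'" "size P' = n"
    using Suc.prems(1) by (metis size_eq_Suc_imp_eq_union size_add_mset nat.inject)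
  have "Im (w - a) < 0" using Suc.prems(3)[of a] P assms(5) by simp
  then obtain c R' where R': "c \<noteq> 0" "size R' = n" "\<forall>b\<in>#R'. Im b \<ge> 0"
      "polar (Suc n) (w - a) (root_poly R) = smult c (root_poly R')"
    using polar_upper_half_plane[of R n "w - a"] Suc.prems by blast
  have "poly (deriv_conv n (root_poly R') (root_poly P')) w \<noteq> 0"
    using Suc.IH[of P' R'] R' P Suc.prems by auto
  then have "poly (deriv_conv n (polar (Suc n) (w - a) (root_poly R)) (root_poly P')) w \<noteq> 0"
    using R' by (simp add: deriv_conv_smult_left)
  moreover have "degree (root_poly P') \<le> n" using P by simp
  ultimately show ?case
    using P poly_deriv_conv_linear_mult[of "root_poly P'" n "root_poly R" a w]
    by (simp del: mult_pCons_left of_nat_Suc)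
qed

section \<open>Real polynomials as complex polynomials, and real-rootedness of the
  convolution\<close>

abbreviation cpoly :: "real poly \<Rightarrow> complex poly" where
  "cpoly \<equiv> map_poly complex_of_real"

lemma cpoly_add: "cpoly (p + q) = cpoly p + cpoly q"
  by (intro poly_eqI) (simp add: coeff_map_poly)

lemma cpoly_smult: "cpoly (smult c p) = smult (complex_of_real c) (cpoly p)"
  by (intro poly_eqI) (simp add: coeff_map_poly)

lemma cpoly_mult: "cpoly (p * q) = cpoly p * cpoly q"
  by (intro poly_eqI) (simp add: coeff_map_poly coeff_mult)

lemma cpoly_pderiv: "cpoly (pderiv p) = pderiv (cpoly p)"
  by (intro poly_eqI) (simp add: coeff_map_poly coeff_pderiv)

lemma cpoly_sum: "cpoly (sum f I) = (\<Sum>i\<in>I. cpoly (f i))"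
  by (induction I rule: infinite_finite_induct) (simp_all add: cpoly_add)

lemma cpoly_root_poly: "cpoly (root_poly A) = root_poly (image_mset complex_of_real A)"
  by (induction A) (simp_all add: cpoly_mult map_poly_pCons del: mult_pCons_left)

lemma cpoly_deriv_conv: "cpoly (deriv_conv d r p) = deriv_conv d (cpoly r) (cpoly p)"
proof -
  have "cpoly ((pderiv ^^ i) p) = (pderiv ^^ i) (cpoly p)" for i
    by (induction i) (simp_all add: cpoly_pderiv)
  then show ?thesis
    by (simp add: deriv_conv_def cpoly_sum cpoly_smult coeff_map_poly)
qed

lemma cpoly_inject: "cpoly p = cpoly q \<Longrightarrow> p = q"
  by (metis coeff_map_poly of_real_0 of_real_eq_iff poly_eqI)

lemma cpoly_cnj: "poly (cpoly p) (cnj z) = cnj (poly (cpoly p) z)"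
  by (induction p) (simp_all add: map_poly_pCons)

text \<open>Nonreal roots of a real polynomial come in conjugate pairs, one of which would lie in
  the lower half plane.\<close>

lemma real_rooted_if_no_lower_roots:
  assumes "p \<noteq> 0" "\<And>w. Im w < 0 \<Longrightarrow> poly (cpoly p) w \<noteq> 0"
  shows "\<exists>A. size A = degree p \<and> p = smult (lead_coeff p) (root_poly A)"
proof -
  have nz: "cpoly p \<noteq> 0" using assms(1) by (metis cpoly_inject map_poly_0)
  have deg: "degree (cpoly p) = degree p" by (simp add: degree_map_poly)
  obtain A where A: "size A = degree p" "cpoly p = smult (lead_coeff (cpoly p)) (root_poly A)"
    using alg_closed_imp_factorization[OF nz, folded root_poly_def] deg by auto
  have "Im z = 0" if "z \<in># A" for z
  proof -
    have "poly (root_poly A) z = 0" using that by (simp add: poly_root_poly)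
    then have "poly (cpoly p) z = 0" by (metis A(2) poly_smult mult_zero_right)
    then show ?thesis
      using assms(2)[of z] assms(2)[of "cnj z"] cpoly_cnj[of p z] by (cases "Im z" "0::real" rule: linorder_cases) auto
  qed
  then have "image_mset complex_of_real (image_mset Re A) = A"
    by (simp add: image_mset.compositionality o_def complex_is_Real_iff cong: image_mset_cong)
  then have "cpoly p = cpoly (smult (lead_coeff p) (root_poly (image_mset Re A)))"
    using A(2) by (simp add: cpoly_smult cpoly_root_poly deg coeff_map_poly)
  then show ?thesis
    using A(1) by (intro exI[of _ "image_mset Re A"]) (auto dest: cpoly_inject)
qed

lemma deriv_conv_real_rooted:
  fixes P R :: "real multiset"
  assumes "size P = d" "size R = d"
  shows "\<exists>A. size A = d \<and> deriv_conv d (root_poly R) (root_poly P) = root_poly A"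
proof -
  let ?f = "deriv_conv d (root_poly R) (root_poly P)"
  have c: "coeff ?f d = 1"
    using coeff_deriv_conv_top[of "root_poly P" d "root_poly R"] assms lead_coeff_root_poly[of P]
      lead_coeff_root_poly[of R] by simp
  have "degree ?f \<le> d" using degree_deriv_conv[of "root_poly P" d] assms by simp
  then have deg: "degree ?f = d" using c le_degree[of ?f d] by simp
  have "poly (cpoly ?f) w \<noteq> 0" if "Im w < 0" for w
    unfolding cpoly_deriv_conv cpoly_root_poly
    by (rule deriv_conv_nonzero_lower_half_plane) (use assms that in auto)
  moreover have "?f \<noteq> 0" using c by auto
  ultimately show ?thesis
    using real_rooted_if_no_lower_roots[of ?f] c deg by auto
qed

text \<open>By linearity, \<open>F x = U - x V\<close>. Were \<open>Im (U * cnj V)\<close> positive,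
  \<open>z = U / V\<close> would lie in the upper half plane, and inserting \<open>z\<close> as a
  root would give the value \<open>0\<close>.\<close>

lemma Im_deriv_conv_lower_half_plane:
  fixes G R :: "real multiset"
  assumes "size G = n" "size R = Suc n" "Im w < 0"
  defines "F \<equiv> \<lambda>a. poly (cpoly (deriv_conv (Suc n) (root_poly R) (root_poly (add_mset a G)))) w"
  assumes "a \<le> b"
  shows "Im (F b * cnj (F a)) \<le> 0"
proof -
  let ?T = "\<lambda>p. poly (deriv_conv (Suc n) (cpoly (root_poly R)) p) w"
  let ?g = "cpoly (root_poly G)"
  define U where "U = ?T (pCons 0 ?g)"
  define V where "V = ?T ?g"
  have lin: "?T ([:-z, 1:] * ?g) = U - z * V" for z
    by (simp add: U_def V_def deriv_conv_diff deriv_conv_smult)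
  have F: "F x = U - of_real x * V" for x
    unfolding F_def cpoly_deriv_conv root_poly_add_mset cpoly_mult
    using lin[of "of_real x"] by (simp add: map_poly_pCons del: mult_pCons_left)
  have nz: "U - z * V \<noteq> 0" if "Im z \<ge> 0" for z
  proof -
    have "?T (root_poly (add_mset z (image_mset of_real G))) \<noteq> 0"
      unfolding cpoly_root_poly
      by (rule deriv_conv_nonzero_lower_half_plane) (use assms that in auto)
    then show ?thesis using lin[of z] by (simp add: cpoly_root_poly del: mult_pCons_left)
  qed
  have "Im (U * cnj V) \<le> 0"
  proof (rule ccontr)
    assume "\<not> Im (U * cnj V) \<le> 0"
    then have V: "V \<noteq> 0" and *: "Im (U * cnj V) > 0" by auto
    have "Im (U / V) = Im (U * cnj V) / (cmod V)\<^sup>2"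
      by (simp add: Im_divide cmod_power2 field_simps)
    then have "Im (U / V) \<ge> 0" using * by simp
    then show False using nz[of "U / V"] V by simp
  qed
  moreover have "Im (F b * cnj (F a)) = (b - a) * Im (U * cnj V)"
    by (simp add: F algebra_simps)
  ultimately show ?thesis using \<open>a \<le> b\<close> by (simp add: mult_nonneg_nonpos)
qed

section \<open>Counting roots by arguments\<close>

text \<open>Up to a constant depending only on \<open>size A\<close>, a branch, continuous in
  \<open>t > 0\<close>, of the argument of the product of the \<open>w - a\<close> at
  \<open>w = x + t - i t^2\<close>.\<close>

definition arctan_sum :: "real multiset \<Rightarrow> real \<Rightarrow> real \<Rightarrow> real" where
  "arctan_sum A x t = (\<Sum>a\<in>#A. arctan ((x + t - a) / t\<^sup>2))"

text \<open>Here \<open>u - i y = -i (y + i u)\<close>, and \<open>y + i u\<close> lies in the right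
  half plane, where the argument is an arctangent.\<close>

lemma complex_eq_cis_arctan:
  assumes "y > 0"
  shows "Complex u (- y) = of_real (y * sqrt (1 + (u / y)\<^sup>2)) * (- \<i> * cis (arctan (u / y)))"
proof -
  have "sqrt (1 + (u / y)\<^sup>2) > 0" by (simp add: add_pos_nonneg)
  then show ?thesis
    using assms by (simp add: complex_eq_iff cos_arctan sin_arctan)
qed

lemma prod_mset_eq_cis_arctan_sum:
  fixes x t :: real
  assumes "t > 0"
  defines "w \<equiv> Complex (x + t) (- (t\<^sup>2))"
  shows "\<exists>c>0. (\<Prod>a\<in>#image_mset complex_of_real A. w - a)
    = of_real c * (- \<i>) ^ size A * cis (arctan_sum A x t)"
proof (induction A)
  case empty
  show ?case by (intro exI[of _ 1]) (simp add: arctan_sum_def)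
next
  case (add a A)
  then obtain c where c: "c > 0" "(\<Prod>a\<in>#image_mset complex_of_real A. w - a)
    = of_real c * (- \<i>) ^ size A * cis (arctan_sum A x t)" by blast
  define u where "u = (x + t - a) / t\<^sup>2"
  define k where "k = t\<^sup>2 * sqrt (1 + u\<^sup>2)"
  have "w - of_real a = Complex (x + t - a) (- (t\<^sup>2))" by (simp add: w_def complex_eq_iff)
  also have "\<dots> = of_real k * (- \<i> * cis (arctan u))"
    unfolding k_def u_def by (rule complex_eq_cis_arctan) (use assms in simp)
  finally have "w - of_real a = of_real k * (- \<i> * cis (arctan u))" .
  moreover have "k > 0" using assms(1) by (simp add: k_def add_pos_nonneg)
  moreover have "arctan_sum (add_mset a A) x t = arctan u + arctan_sum A x t"
    by (simp add: arctan_sum_def u_def)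
  ultimately show ?case
    using c by (intro exI[of _ "k * c"]) (simp add: cis_mult[symmetric] mult_ac)
qed

text \<open>Equal sizes make the powers of \<open>- \<i>\<close> cancel, which leaves a positive
  multiple of \<open>cis\<close> of the difference of the arguments.\<close>

lemma Im_prod_sign:
  fixes x t :: real
  assumes "t > 0" "size A = size B"
  defines "w \<equiv> Complex (x + t) (- (t\<^sup>2))"
  assumes "Im ((\<Prod>b\<in>#image_mset complex_of_real B. w - b) *
    cnj (\<Prod>a\<in>#image_mset complex_of_real A. w - a)) \<le> 0"
  shows "sin (arctan_sum B x t - arctan_sum A x t) \<le> 0"
proof -
  obtain c where c: "c > 0" "(\<Prod>a\<in>#image_mset complex_of_real A. w - a)
    = of_real c * (- \<i>) ^ size A * cis (arctan_sum A x t)"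
    using prod_mset_eq_cis_arctan_sum[OF assms(1), of x A] unfolding w_def by blast
  obtain c' where c': "c' > 0" "(\<Prod>a\<in>#image_mset complex_of_real B. w - a)
    = of_real c' * (- \<i>) ^ size B * cis (arctan_sum B x t)"
    using prod_mset_eq_cis_arctan_sum[OF assms(1), of x B] unfolding w_def by blast
  have "(- \<i>) ^ size B * cnj ((- \<i>) ^ size A) = 1"
    by (simp add: assms(2) power_mult_distrib[symmetric])
  then have e: "(of_real c' * (- \<i>) ^ size B * u) * cnj (of_real c * (- \<i>) ^ size A * v)
      = of_real (c' * c) * (u * cnj v)" for u v
    by (simp add: algebra_simps)
  have "(\<Prod>b\<in>#image_mset complex_of_real B. w - b) *
    cnj (\<Prod>a\<in>#image_mset complex_of_real A. w - a)
    = of_real (c' * c) * cis (arctan_sum B x t - arctan_sum A x t)"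
    unfolding c c' e by (simp add: cis_cnj cis_mult)
  then have "c' * c * sin (arctan_sum B x t - arctan_sum A x t) \<le> 0"
    using assms(4) by simp
  then show ?thesis using c(1) c'(1) by (simp add: mult_le_0_iff)
qed

lemma arctan_sum_at_top: "(arctan_sum A x \<longlongrightarrow> 0) at_top"
proof (induction A)
  case (add a A)
  have "((\<lambda>t. arctan ((x + t - a) / t\<^sup>2)) \<longlongrightarrow> 0) at_top" by real_asymp
  from tendsto_add[OF this add] show ?case by (simp add: arctan_sum_def[abs_def])
qed (simp add: arctan_sum_def[abs_def])

text \<open>Along \<open>x + t - i t\<^sup>2\<close> the real part approaches \<open>x\<close> from the right and more slowly than the
  imaginary part vanishes, so that a root at \<open>x\<close> itself contributes \<open>pi / 2\<close> like the roots below it.\<close>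
lemma arctan_sum_at_right_0:
  "(arctan_sum A x \<longlongrightarrow> pi * real (size (filter_mset (\<lambda>a. a \<le> x) A)) - pi / 2 * real (size A)) (at_right 0)"
proof (induction A)
  case (add a A)
  have "((\<lambda>t. arctan ((x + t - a) / t\<^sup>2)) \<longlongrightarrow> (if a \<le> x then pi / 2 else - pi / 2)) (at_right 0)"
  proof -
    consider "a = x" | "x - a > 0" | "x - a < 0" by linarith
    then show ?thesis
    proof cases
      case 1
      have "((\<lambda>t::real. arctan (t / t\<^sup>2)) \<longlongrightarrow> pi / 2) (at_right 0)" by real_asymp
      then show ?thesis using 1 by simp
    next
      case 2
      define b where "b = x - a"
      have "b > 0" using 2 by (simp add: b_def)
      then have "((\<lambda>t::real. arctan ((b + t) / t\<^sup>2)) \<longlongrightarrow> pi / 2) (at_right 0)" by real_asymp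
      then show ?thesis using 2 by (simp add: b_def algebra_simps)
    next
      case 3
      define b where "b = x - a"
      have "b < 0" using 3 by (simp add: b_def)
      then have "((\<lambda>t::real. arctan ((b + t) / t\<^sup>2)) \<longlongrightarrow> - pi / 2) (at_right 0)" by real_asymp
      then show ?thesis using 3 by (simp add: b_def algebra_simps)
    qed
  qed
  from tendsto_add[OF this add] show ?case
    by (auto simp: arctan_sum_def[abs_def] algebra_simps add_divide_distrib split: if_splits)
qed (simp add: arctan_sum_def[abs_def])

lemma continuous_on_arctan_sum: "continuous_on {0<..} (arctan_sum A x)"
proof (induction A)
  case (add a A)
  have "continuous_on {0<..} (\<lambda>t. arctan ((x + t - a) / t\<^sup>2))"
    by (intro continuous_intros) auto
  from continuous_on_add[OF this add] show ?case by (simp add: arctan_sum_def[abs_def])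
qed (simp add: arctan_sum_def[abs_def])

text \<open>The sine is positive on \<open>(0, pi)\<close> and on \<open>(-2 pi, -pi)\<close>.
  Coming from \<open>0\<close> at infinity, \<open>D\<close> would have to enter one of these
  intervals to leave \<open>[-pi, 0]\<close>.\<close>

lemma nonpos_sin_imp_bounds:
  fixes D :: "real \<Rightarrow> real"
  assumes cont: "continuous_on {0<..} D" and lim: "(D \<longlongrightarrow> 0) at_top"
    and sin: "\<And>t. t > 0 \<Longrightarrow> sin (D t) \<le> 0" and t: "t > 0"
  shows "- pi \<le> D t \<and> D t \<le> 0"
proof -
  \<comment> \<open>Far out \<open>D\<close> is smaller than \<open>c\<close> in absolute value, so
    the intermediate value theorem yields every nonzero value between \<open>0\<close> and
    \<open>D t\<close>.\<close>
  have reach: "\<exists>s>0. D s = c" if "0 < c \<and> c \<le> D t \<or> D t \<le> c \<and> c < 0" for c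
  proof -
    have "\<forall>\<^sub>F s in at_top. \<bar>D s\<bar> < \<bar>c\<bar>"
      using tendstoD[OF lim, of "\<bar>c\<bar>"] that by (auto simp: dist_real_def)
    then obtain N where N: "\<And>s. s \<ge> N \<Longrightarrow> \<bar>D s\<bar> < \<bar>c\<bar>" by (auto simp: eventually_at_top_linorder)
    define s where "s = max t N"
    have s: "t \<le> s" "\<bar>D s\<bar> < \<bar>c\<bar>" using N by (auto simp: s_def)
    have ct: "continuous_on {t..s} D" by (rule continuous_on_subset[OF cont]) (use t in auto)
    have "\<exists>u\<ge>t. u \<le> s \<and> D u = c"
    proof (cases "c > 0")
      case True
      then show ?thesis using that s by (intro IVT2'[OF _ _ _ ct]) auto
    next
      case False
      then show ?thesis using that s by (intro IVT'[OF _ _ _ ct]) auto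
    qed
    then obtain u where "t \<le> u" "D u = c" by blast
    then show ?thesis using t by (intro exI[of _ u]) simp
  qed
  have "D t \<le> 0"
  proof (rule ccontr)
    assume "\<not> D t \<le> 0"
    then obtain s where "s > 0" "D s = min (D t) (pi / 2)" using reach[of "min (D t) (pi / 2)"] by auto
    moreover have "sin (min (D t) (pi / 2)) > 0"
      using \<open>\<not> D t \<le> 0\<close> by (intro sin_gt_zero) (auto simp: min_def pi_gt_zero)
    ultimately show False using sin[of s] by auto
  qed
  moreover have "- pi \<le> D t"
  proof (rule ccontr)
    assume n: "\<not> - pi \<le> D t"
    \<comment> \<open>The midpoint of \<open>(-2 pi, -pi)\<close>; the maximum with
      \<open>D t\<close> keeps \<open>c\<close> both inside this interval and attained.\<close>
    define c where "c = max (D t) (- 3 * pi / 2)"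
    have c: "D t \<le> c" "c < - pi" "- 2 * pi < c" using n pi_gt_zero by (auto simp: c_def max_def)
    then obtain s where "s > 0" "D s = c" using reach[of c] pi_gt_zero by force
    moreover have "sin (c + 2 * pi) > 0" using c by (intro sin_gt_zero) auto
    then have "sin c > 0" by simp
    ultimately show False using sin[of s] by auto
  qed
  ultimately show ?thesis by simp
qed

text \<open>The limit at infinity fixes the branch, so the difference of the arguments stays in
  \<open>[-pi, 0]\<close>. As \<open>t\<close> tends to \<open>0\<close> it approaches
  \<open>pi\<close> times the difference of the root counts.\<close>

lemma count_roots_interlace:
  fixes A B :: "real multiset"
  assumes sz: "size A = size B"
    and Im: "\<And>w. Im w < 0 \<Longrightarrow> Im ((\<Prod>b\<in>#image_mset complex_of_real B. w - b) *
      cnj (\<Prod>a\<in>#image_mset complex_of_real A. w - a)) \<le> 0"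
  shows "size (filter_mset (\<lambda>b. b \<le> x) B) \<le> size (filter_mset (\<lambda>a. a \<le> x) A) \<and>
    size (filter_mset (\<lambda>a. a \<le> x) A) \<le> size (filter_mset (\<lambda>b. b \<le> x) B) + 1"
proof -
  let ?N = "\<lambda>A. real (size (filter_mset (\<lambda>a. a \<le> x) A))"
  define D where "D t = arctan_sum B x t - arctan_sum A x t" for t
  have bounds: "- pi \<le> D t \<and> D t \<le> 0" if "t > 0" for t
  proof (rule nonpos_sin_imp_bounds[OF _ _ _ that])
    show "continuous_on {0<..} D"
      unfolding D_def by (intro continuous_on_diff continuous_on_arctan_sum)
    show "(D \<longlongrightarrow> 0) at_top"
      unfolding D_def using tendsto_diff[OF arctan_sum_at_top arctan_sum_at_top] by simp
    show "sin (D t) \<le> 0" if "t > 0" for t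
      unfolding D_def by (rule Im_prod_sign[OF that sz]) (rule Im, use that in simp)
  qed
  have "(D \<longlongrightarrow> pi * (?N B - ?N A)) (at_right 0)"
    using tendsto_diff[OF arctan_sum_at_right_0 arctan_sum_at_right_0, of B x A x] sz
    by (simp add: D_def[abs_def] algebra_simps)
  moreover have "\<forall>\<^sub>F t in at_right 0. - pi \<le> D t" "\<forall>\<^sub>F t in at_right 0. D t \<le> 0"
    using bounds by (auto simp: eventually_at_right_less intro!: eventually_at_rightI[of 0 1])
  ultimately have "- pi \<le> pi * (?N B - ?N A)" "pi * (?N B - ?N A) \<le> 0"
    by (auto intro: tendsto_lowerbound tendsto_upperbound)
  then have "pi * (-1) \<le> pi * (?N B - ?N A)" "pi * (?N B - ?N A) \<le> pi * 0" by simp_all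
  then show ?thesis
    by (simp only: mult_le_cancel_left_pos[OF pi_gt_zero]) linarith
qed

section \<open>Comparison of root counts\<close>

abbreviation roots_le :: "real multiset \<Rightarrow> real \<Rightarrow> nat" where
  "roots_le A x \<equiv> size (filter_mset (\<lambda>a. a \<le> x) A)"

text \<open>For \<open>size R = size P\<close> the convolution is real-rooted, so that
  \<open>proots\<close> captures all of its roots.\<close>

definition conv_roots :: "real multiset \<Rightarrow> real multiset \<Rightarrow> real multiset" where
  "conv_roots R P = proots (deriv_conv (size P) (root_poly R) (root_poly P))"

lemma
  assumes "size R = size P"
  shows root_poly_conv_roots:
      "root_poly (conv_roots R P) = deriv_conv (size P) (root_poly R) (root_poly P)"
    and size_conv_roots: "size (conv_roots R P) = size P"
  using deriv_conv_real_rooted[OF refl assms] unfolding conv_roots_def by auto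

lemma conv_roots_interlace:
  assumes "size R = Suc (size G)" "a \<le> b"
  shows "roots_le (conv_roots R (add_mset b G)) x \<le> roots_le (conv_roots R (add_mset a G)) x \<and>
    roots_le (conv_roots R (add_mset a G)) x \<le> roots_le (conv_roots R (add_mset b G)) x + 1"
proof (rule count_roots_interlace)
  show "size (conv_roots R (add_mset a G)) = size (conv_roots R (add_mset b G))"
    using assms by (simp add: size_conv_roots)
  fix w :: complex assume w: "Im w < 0"
  have "(\<Prod>c\<in>#image_mset complex_of_real (conv_roots R (add_mset z G)). w - c)
      = poly (cpoly (deriv_conv (Suc (size G)) (root_poly R) (root_poly (add_mset z G)))) w" for z
    using root_poly_conv_roots[of R "add_mset z G", symmetric] assms
    by (simp add: cpoly_root_poly poly_root_poly del: root_poly_add_mset)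
  then show "Im ((\<Prod>c\<in>#image_mset complex_of_real (conv_roots R (add_mset b G)). w - c) *
      cnj (\<Prod>c\<in>#image_mset complex_of_real (conv_roots R (add_mset a G)). w - c)) \<le> 0"
    using Im_deriv_conv_lower_half_plane[OF refl assms(1) w assms(2)] by simp
qed

text \<open>The roots of \<open>p\<close> are turned into those of \<open>q\<close> one at a time, \<open>C\<close> being the part already
  dealt with. For \<open>k = 0\<close> the largest root moves up to the largest root of \<open>q\<close>. For \<open>k > 0\<close> it
  moves to the smallest root of \<open>q\<close>, which uses up one unit of \<open>k\<close>.\<close>
lemma conv_roots_count_mono:
  assumes "size A = size B" "size R = size (C + A)"
    and "\<And>x. roots_le B x \<le> roots_le A x + k"
  shows "roots_le (conv_roots R (C + B)) x \<le> roots_le (conv_roots R (C + A)) x + k"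
  using assms
proof (induction "size A" arbitrary: A B C k)
  case 0
  then show ?case by simp
next
  case (Suc n)
  have "A \<noteq> {#}" "B \<noteq> {#}" using Suc.hyps(2) Suc.prems(1) by auto
  define a where "a = Max_mset A"
  define A' where "A' = A - {#a#}"
  have a: "A = add_mset a A'" "\<And>y. y \<in># A' \<Longrightarrow> y \<le> a"
    using \<open>A \<noteq> {#}\<close> by (auto simp: a_def A'_def dest: in_diffD)
  have A'_full: "roots_le A' y = size A'" if "a \<le> y" for y
    using a(2) that by (force intro!: arg_cong[of _ _ size] filter_mset_eq_conv[THEN iffD2])
  have sizes: "size A' = n" "size R = Suc (size (C + A'))" using Suc a by auto
  show ?case
  proof (cases k)
    case 0
    define b where "b = Max_mset B"
    define B' where "B' = B - {#b#}"
    have b: "B = add_mset b B'" "\<And>y. y \<in># B \<Longrightarrow> y \<le> b"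
      using \<open>B \<noteq> {#}\<close> by (auto simp: b_def B'_def)
    \<comment> \<open>All of \<open>B\<close> lies at or below \<open>b\<close>; with
      \<open>k = 0\<close> the hypothesis forces the same for \<open>A\<close>, hence
      \<open>a \<le> b\<close>.\<close>
    have "roots_le B b = size B"
      using b(2) by (force intro!: arg_cong[of _ _ size] filter_mset_eq_conv[THEN iffD2])
    then have *: "size A \<le> roots_le A b" using Suc.prems(3)[of b] Suc.prems(1) 0 by simp
    have "a \<le> b"
    proof (rule ccontr)
      assume "\<not> a \<le> b"
      then have "size A \<le> roots_le A' b" using * a(1) by simp
      also have "\<dots> \<le> size A'" by (rule size_filter_mset_lesseq)
      finally show False using a(1) by simp
    qed
    \<comment> \<open>From \<open>a\<close> on all of \<open>A'\<close> is counted. To the left of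
      \<open>a\<close> neither count changes, as both removed roots lie further right.\<close>
    have "roots_le B' y \<le> roots_le A' y + 0" for y
    proof (cases "a \<le> y")
      case True
      then show ?thesis using A'_full[OF True] size_filter_mset_lesseq[of "\<lambda>a. a \<le> y" B'] Suc.prems(1) a b by simp
    next
      case False
      then show ?thesis using Suc.prems(3)[of y] a(1) b(1) \<open>a \<le> b\<close> 0 by simp
    qed
    then have "roots_le (conv_roots R (add_mset b C + B')) x \<le> roots_le (conv_roots R (add_mset b C + A')) x + 0"
      using Suc.hyps(1)[of A' B' "add_mset b C" 0] sizes Suc.prems(1) a(1) b(1) by simp
    moreover have "roots_le (conv_roots R (add_mset b (C + A'))) x \<le> roots_le (conv_roots R (add_mset a (C + A'))) x"
      using conv_roots_interlace[OF sizes(2) \<open>a \<le> b\<close>] by blast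
    ultimately show ?thesis using a(1) b(1) 0 by simp
  next
    case (Suc j)
    define b where "b = Min_mset B"
    define B' where "B' = B - {#b#}"
    have b: "B = add_mset b B'" "\<And>y. y \<in># B' \<Longrightarrow> b \<le> y"
      using \<open>B \<noteq> {#}\<close> by (auto simp: b_def B'_def dest: in_diffD)
    \<comment> \<open>From \<open>a\<close> on all of \<open>A'\<close> is counted, and below
      \<open>b\<close> nothing of \<open>B'\<close> is. In between, removing \<open>b\<close> lowers
      the count of \<open>B\<close> by one and that of \<open>A\<close> not at all, so
      \<open>k\<close> drops to \<open>j\<close>.\<close>
    have "roots_le B' y \<le> roots_le A' y + j" for y
    proof -
      consider "a \<le> y" | "y < a" "b \<le> y" | "y < b" by linarith
      then show ?thesis
      proof cases
        case 1
        then have "roots_le A' y = size B'" using A'_full \<open>size A = size B\<close> a(1) b(1) by simp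
        then show ?thesis by (simp add: trans_le_add1 size_filter_mset_lesseq)
      next
        case 2
        then show ?thesis using Suc.prems(3)[of y] a(1) b(1) Suc by simp
      next
        case 3
        then have "filter_mset (\<lambda>z. z \<le> y) B' = {#}"
          using b(2) by (force simp: filter_mset_eq_conv)
        then have "roots_le B' y = 0" by (simp only: size_empty)
        then show ?thesis by linarith
      qed
    qed
    then have "roots_le (conv_roots R (add_mset b C + B')) x \<le> roots_le (conv_roots R (add_mset b C + A')) x + j"
      using Suc.hyps(1)[of A' B' "add_mset b C" j] sizes \<open>size A = size B\<close> a(1) b(1) by simp
    \<comment> \<open>Here \<open>b\<close> may lie on either side of \<open>a\<close>: a move to
      the right does not raise the count, and a move to the left raises it by at most one.\<close>
    moreover have "roots_le (conv_roots R (add_mset b (C + A'))) x \<le> roots_le (conv_roots R (add_mset a (C + A'))) x + 1"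
      using conv_roots_interlace[OF sizes(2), of a b x] conv_roots_interlace[OF sizes(2), of b a x]
      by (cases "a \<le> b") auto
    ultimately show ?thesis using a(1) b(1) Suc by simp
  qed
qed

section \<open>Translations, distribution functions and the two distances\<close>

lemma root_poly_shift: "root_poly (image_mset (\<lambda>a. a - s) A) = pcompose (root_poly A) [:s, 1:]"
proof (induction A)
  case (add a A)
  have "pcompose [:-a, 1:] [:s, 1:] = [:-(a - s), 1:]" by (simp add: pcompose_pCons)
  then show ?case using add by (simp only: image_mset_add_mset root_poly_add_mset pcompose_mult)
qed (simp add: pcompose_1)

lemma deriv_conv_shift:
  "deriv_conv d r (pcompose p [:s, 1:]) = pcompose (deriv_conv d r p) [:s, 1:]"
proof -
  have "(pderiv ^^ i) (pcompose p [:s, 1:]) = pcompose ((pderiv ^^ i) p) [:s, 1:]" for i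
    by (induction i) (simp_all add: pderiv_pcompose pderiv_pCons)
  then show ?thesis
    by (simp add: deriv_conv_def pcompose_sum pcompose_smult)
qed

lemma conv_roots_shift:
  assumes "size R = size P"
  shows "conv_roots R (image_mset (\<lambda>a. a - s) P) = image_mset (\<lambda>a. a - s) (conv_roots R P)"
proof -
  have "root_poly (image_mset (\<lambda>a. a - s) (conv_roots R P))
      = deriv_conv (size P) (root_poly R) (root_poly (image_mset (\<lambda>a. a - s) P))"
    by (simp add: root_poly_shift deriv_conv_shift root_poly_conv_roots[OF assms])
  then show ?thesis by (metis conv_roots_def proots_root_poly size_image_mset)
qed

lemma roots_le_shift: "roots_le (image_mset (\<lambda>a. a - s) A) x = roots_le A (x + s)"
  by (simp add: filter_mset_image_mset algebra_simps)

lemma root_cdf_root_poly: "root_cdf d (root_poly A) x = real (roots_le A x) / real d"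
proof -
  have "size (filter_mset (\<lambda>a. a \<le> x) A) = (\<Sum>a\<in>{a \<in> set_mset A. a \<le> x}. count A a)"
    unfolding size_multiset_overloaded_eq by (intro sum.cong) auto
  moreover have "poly (root_poly A) r = 0 \<longleftrightarrow> r \<in># A" for r
    by (auto simp: poly_root_poly)
  moreover have "order r (root_poly A) = count A r" for r
    using count_proots[of "root_poly A" r] by simp
  ultimately show ?thesis by (simp add: root_cdf_def)
qed

text \<open>One one-sided estimate serves both distances: \<open>s = 0\<close> for Kolmogorov and
  \<open>s = e\<close> for Levy. Translating the roots of \<open>p\<close> by \<open>s\<close>
  reduces it to a comparison of root counts at the same point.\<close>

lemma root_cdf_ffconv_shift_le:
  assumes d: "d \<ge> 1" and p: "p \<in> real_rooted_monic d" "q \<in> real_rooted_monic d" "r \<in> real_rooted_monic d"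
    and e: "e \<ge> 0" and le: "\<And>x. root_cdf d q x \<le> root_cdf d p (x + s) + e"
  shows "root_cdf d (ffconv d q r) x \<le> root_cdf d (ffconv d p r) (x + s) + e"
proof -
  obtain P Q R where P: "size P = d" "p = root_poly P" and Q: "size Q = d" "q = root_poly Q"
    and R: "size R = d" "r = root_poly R"
    using p by (auto simp: real_rooted_monic_def root_poly_def)
  have conv: "ffconv d p r = root_poly (conv_roots R P)" "ffconv d q r = root_poly (conv_roots R Q)"
    using P Q R by (simp_all add: ffconv_eq_deriv_conv root_poly_conv_roots)
  define P' where "P' = image_mset (\<lambda>a. a - s) P"
  \<comment> \<open>Root counts are integers, so the bound \<open>d * e\<close> on their difference
    may be rounded down.\<close>
  define k where "k = nat \<lfloor>real d * e\<rfloor>"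
  have k: "real k \<le> real d * e" using e by (simp add: k_def)
  have "roots_le Q y \<le> roots_le P' y + k" for y
  proof -
    have "real (roots_le Q y) / d \<le> real (roots_le P' y) / d + e"
      using le[of y] P Q by (simp add: root_cdf_root_poly P'_def roots_le_shift)
    then have "real (roots_le Q y) \<le> real (roots_le P' y) + d * e"
      using d by (simp add: field_simps)
    then have "int (roots_le Q y) - int (roots_le P' y) \<le> \<lfloor>real d * e\<rfloor>"
      by (simp add: le_floor_iff)
    then show ?thesis by (simp add: k_def)
  qed
  then have "roots_le (conv_roots R ({#} + Q)) x \<le> roots_le (conv_roots R ({#} + P')) x + k"
    by (intro conv_roots_count_mono) (use P Q R in \<open>auto simp: P'_def\<close>)
  then have "real (roots_le (conv_roots R Q) x) \<le> real (roots_le (conv_roots R P) (x + s)) + real d * e"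
    using k P R by (simp add: P'_def conv_roots_shift roots_le_shift)
  then show ?thesis using d by (simp add: conv root_cdf_root_poly field_simps)
qed

lemma root_cdf_bounds:
  assumes "d \<ge> 1" "p \<in> real_rooted_monic d"
  shows "0 \<le> root_cdf d p x" "root_cdf d p x \<le> 1"
proof -
  obtain P where P: "size P = d" "p = root_poly P"
    using assms by (auto simp: real_rooted_monic_def root_poly_def)
  then show "0 \<le> root_cdf d p x" "root_cdf d p x \<le> 1"
    using assms(1) size_filter_mset_lesseq[of "\<lambda>a. a \<le> x" P] by (simp_all add: root_cdf_root_poly)
qed

theorem theorem1p2:
  fixes d :: nat and p q r :: "real poly"
  assumes "d \<ge> 1"
    and "p \<in> real_rooted_monic d" and "q \<in> real_rooted_monic d" and "r \<in> real_rooted_monic d"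
  shows "dK_poly d (ffconv d p r) (ffconv d q r) \<le> dK_poly d p q \<and>
         dL_poly d (ffconv d p r) (ffconv d q r) \<le> dL_poly d p q"
proof
  note pq = root_cdf_ffconv_shift_le[OF assms]
  note qp = root_cdf_ffconv_shift_le[OF assms(1,3,2,4)]
  let ?F = "root_cdf d p" and ?G = "root_cdf d q"
  let ?F' = "root_cdf d (ffconv d p r)" and ?G' = "root_cdf d (ffconv d q r)"
  note bounds = root_cdf_bounds[OF assms(1,2)] root_cdf_bounds[OF assms(1,3)]
  \<comment> \<open>This makes \<open>e = 1\<close> admissible in both distances, so the infima are
    over nonempty sets.\<close>
  have one: "?F y \<le> ?G z + 1" "?G z \<le> ?F y + 1" for y z
    using bounds(1)[of y] bounds(2)[of y] bounds(3)[of z] bounds(4)[of z] by linarith+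
  show "dK_poly d (ffconv d p r) (ffconv d q r) \<le> dK_poly d p q"
    unfolding dK_poly_def kolmogorov_dist_def
  proof (rule cInf_superset_mono)
    show "{e. e > 0 \<and> (\<forall>x. ?F x - e \<le> ?G x \<and> ?G x \<le> ?F x + e)} \<noteq> {}"
      using one by (auto intro!: exI[of _ 1] simp: algebra_simps)
    show "bdd_below {e. e > 0 \<and> (\<forall>x. ?F' x - e \<le> ?G' x \<and> ?G' x \<le> ?F' x + e)}"
      by (rule bdd_belowI[of _ 0]) auto
    show "{e. e > 0 \<and> (\<forall>x. ?F x - e \<le> ?G x \<and> ?G x \<le> ?F x + e)}
        \<subseteq> {e. e > 0 \<and> (\<forall>x. ?F' x - e \<le> ?G' x \<and> ?G' x \<le> ?F' x + e)}"
      using pq[of _ 0] qp[of _ 0] by (auto simp: algebra_simps)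
  qed
  show "dL_poly d (ffconv d p r) (ffconv d q r) \<le> dL_poly d p q"
    unfolding dL_poly_def levy_dist_def
  proof (rule cInf_superset_mono)
    show "{e. e > 0 \<and> (\<forall>x. ?F (x - e) - e \<le> ?G x \<and> ?G x \<le> ?F (x + e) + e)} \<noteq> {}"
      using one by (auto intro!: exI[of _ 1] simp: algebra_simps)
    show "bdd_below {e. e > 0 \<and> (\<forall>x. ?F' (x - e) - e \<le> ?G' x \<and> ?G' x \<le> ?F' (x + e) + e)}"
      by (rule bdd_belowI[of _ 0]) auto
    have "?F' (x - e) - e \<le> ?G' x \<and> ?G' x \<le> ?F' (x + e) + e"
      if e: "e > 0" and le: "\<And>x. ?F (x - e) - e \<le> ?G x \<and> ?G x \<le> ?F (x + e) + e" for e x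
    proof
      \<comment> \<open>The lower Levy bound is the upper one with \<open>p\<close> and
        \<open>q\<close> exchanged, read at \<open>x - e\<close>.\<close>
      have "?F y \<le> ?G (y + e) + e" for y using le[of "y + e"] by simp
      then show "?F' (x - e) - e \<le> ?G' x" using qp[of e e "x - e"] e by simp
      show "?G' x \<le> ?F' (x + e) + e" using pq[of e e x] e le by simp
    qed
    then show "{e. e > 0 \<and> (\<forall>x. ?F (x - e) - e \<le> ?G x \<and> ?G x \<le> ?F (x + e) + e)}
        \<subseteq> {e. e > 0 \<and> (\<forall>x. ?F' (x - e) - e \<le> ?G' x \<and> ?G' x \<le> ?F' (x + e) + e)}"
      by blast
  qed
qed

end
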